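(* Let $K=\{\alpha_n: n\in\mathbb N\}\cup\{0\}$ where $(\alpha_n)_{n\in\mathbb N}$ is a strictly decreasing null sequence in $\mathbb R$, and let $S\subseteq\mathbb Q_{>0}$, ordered as a subset of $\mathbb Q$. Then the prime ideals of the vector lattice $R_S(K)$ are exactly the following, and they are pairwise distinct: the maximal ideals $M_{\alpha_n}$, $n\in\mathbb N$, and the ideals $\psi^{-1}(I_U)\subseteq M_0$, where $U$ ranges over all upper sets of $S$ (including $\emptyset$ and $S$). In other words, the set of prime ideals of $R_S(K)$ is in this way identified with $\mathcal U_S\sqcup (K\setminus\{0\})$, where $\mathcal U_S$ is the collection of upper sets of $S$.
   Context: An (order) ideal of a vector lattice $E$ is a linear subspace $I$ such that $|x|\le|y|$, $x\in E$, $y\in I$ imply $x\in I$. A proper ideal $P$ is prime if $x\wedge y\in P$ implies $x\in P$ or $y\in P$. Put $S_0=S\cup\{0\}$ (with $t^0=1$). $R_S(K)\subseteq C(K)$ is the set of all continuous functions $f:K\to\mathbb R$ for which there are $\varepsilon>0$, $n\in\mathbb N$, $s_0,\dots,s_n\in S_0$ and real $a_0,\dots,a_n$ with $f(t)=\sum_{k=0}^n a_kt^{s_k}$ for all $t\in[0,\varepsilon)\cap K$. It is a vector sublattice of $C(K)$ (pointwise order), and the representation of $f$ near $0$ (with distinct exponents and nonzero coefficients) is unique. For $t_0\in K$, $M_{t_0}=\{f\in R_S(K): f(t_0)=0\}$. $\mathrm{Lex}(S)$ is the vector space of finitely supported functions $S\to\mathbb R$, ordered by: $g\ge0$ iff $g=0$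 or $g(s)>0$ where $s$ is the smallest element of the support of $g$; $e_s$ denotes the indicator function of $\{s\}$. The linear map $\psi:M_0\to\mathrm{Lex}(S)$ sends $f\in M_0$ with $f(t)=\sum_k a_kt^{s_k}$ near $0$ ($s_k\in S$) to $\sum_k a_ke_{s_k}$. An upper set of $S$ is a subset $U\subseteq S$ such that $u\in U$, $s\in S$, $s\ge u$ imply $s\in U$; and $I_U=\{g\in\mathrm{Lex}(S):\mathrm{supp}(g)\subseteq U\}$. *)

theory Defs
  imports Complex_Main "HOL-Library.Poly_Mapping"
begin

section \<open>Order ideals in vector lattices of functions\<close>

text \<open>
  The vector lattice is given by a carrier \<open>E\<close> of real-valued functions that is closed under the
  pointwise vector lattice operations. In such an \<open>E\<close> the order, the modulus and the
  infimum are the pointwise ones.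
\<close>

definition linear_subspace :: "('a \<Rightarrow> real) set \<Rightarrow> ('a \<Rightarrow> real) set \<Rightarrow> bool" where
  "linear_subspace E I \<longleftrightarrow> I \<subseteq> E \<and> (\<lambda>_. 0) \<in> I
     \<and> (\<forall>f\<in>I. \<forall>g\<in>I. (\<lambda>t. f t + g t) \<in> I)
     \<and> (\<forall>c. \<forall>f\<in>I. (\<lambda>t. c * f t) \<in> I)"

definition order_ideal :: "('a \<Rightarrow> real) set \<Rightarrow> ('a \<Rightarrow> real) set \<Rightarrow> bool" where
  "order_ideal E I \<longleftrightarrow> linear_subspace E I
     \<and> (\<forall>x\<in>E. \<forall>y\<in>I. (\<forall>t. \<bar>x t\<bar> \<le> \<bar>y t\<bar>) \<longrightarrow> x \<in> I)"

definition prime_order_ideal :: "('a \<Rightarrow> real) set \<Rightarrow> ('a \<Rightarrow> real) set \<Rightarrow> bool" where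
  "prime_order_ideal E P \<longleftrightarrow> order_ideal E P \<and> P \<noteq> E
     \<and> (\<forall>x\<in>E. \<forall>y\<in>E. inf x y \<in> P \<longrightarrow> x \<in> P \<or> y \<in> P)"

definition maximal_order_ideal :: "('a \<Rightarrow> real) set \<Rightarrow> ('a \<Rightarrow> real) set \<Rightarrow> bool" where
  "maximal_order_ideal E M \<longleftrightarrow> order_ideal E M \<and> M \<noteq> E
     \<and> (\<forall>J. order_ideal E J \<and> M \<subseteq> J \<and> J \<noteq> E \<longrightarrow> J = M)"


section \<open>The vector lattice \<open>R\<^sub>S(K)\<close>\<close>

text \<open>The case distinction is needed because \<open>0 powr 0 = 0\<close> in the library.\<close>

definition rat_pow :: "real \<Rightarrow> rat \<Rightarrow> real" where
  "rat_pow t s = (if s = 0 then 1 else t powr of_rat s)"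

text \<open>
  A function on \<open>K\<close> is represented by its extension by \<open>0\<close> to the whole real line, so that
  equality of functions on \<open>K\<close> is equality in HOL.
\<close>

definition CK :: "real set \<Rightarrow> (real \<Rightarrow> real) set" where
  "CK K = {f. continuous_on K f \<and> (\<forall>t. t \<notin> K \<longrightarrow> f t = 0)}"

definition RSK :: "rat set \<Rightarrow> real set \<Rightarrow> (real \<Rightarrow> real) set" where
  "RSK S K = {f \<in> CK K. \<exists>\<epsilon>>0. \<exists>n::nat. \<exists>s a. (\<forall>k\<le>n. s k \<in> S \<union> {0})
     \<and> (\<forall>t\<in>{0..<\<epsilon>} \<inter> K. f t = (\<Sum>k\<le>n. a k * rat_pow t (s k)))}"

definition MSK :: "rat set \<Rightarrow> real set \<Rightarrow> real \<Rightarrow> (real \<Rightarrow> real) set" where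
  "MSK S K t\<^sub>0 = {f \<in> RSK S K. f t\<^sub>0 = 0}"


section \<open>The map \<open>\<psi>\<close> and the ideals \<open>\<psi>\<^sup>-\<^sup>1(I\<^sub>U)\<close>\<close>

definition Lex :: "rat set \<Rightarrow> (rat \<Rightarrow>\<^sub>0 real) set" where
  "Lex S = {g. Poly_Mapping.keys g \<subseteq> S}"

text \<open>
  \<open>Poly_Mapping.single s a\<close> is \<open>a e\<^sub>s\<close>. Empty sums (\<open>n = 0\<close>) are admitted so that functions
  vanishing near \<open>0\<close> have a representation also if \<open>S\<close> is empty. The description is only
  meaningful for \<open>f \<in> MSK S K 0\<close>, with \<open>0\<close> an accumulation point of \<open>K\<close>
  and \<open>K\<close> contained in the nonnegative reals.
\<close>

definition psi :: "rat set \<Rightarrow> real set \<Rightarrow> (real \<Rightarrow> real) \<Rightarrow> (rat \<Rightarrow>\<^sub>0 real)" where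
  "psi S K f = (THE g. \<exists>\<epsilon>>0. \<exists>n::nat. \<exists>s a. (\<forall>k<n. s k \<in> S)
     \<and> (\<forall>t\<in>{0..<\<epsilon>} \<inter> K. f t = (\<Sum>k<n. a k * rat_pow t (s k)))
     \<and> g = (\<Sum>k<n. Poly_Mapping.single (s k) (a k)))"

definition upper_sets :: "rat set \<Rightarrow> rat set set" where
  "upper_sets S = {U. U \<subseteq> S \<and> (\<forall>u\<in>U. \<forall>s\<in>S. u \<le> s \<longrightarrow> s \<in> U)}"

definition I_upper :: "rat set \<Rightarrow> rat set \<Rightarrow> (rat \<Rightarrow>\<^sub>0 real) set" where
  "I_upper S U = {g \<in> Lex S. Poly_Mapping.keys g \<subseteq> U}"

definition psi_preimage :: "rat set \<Rightarrow> real set \<Rightarrow> rat set \<Rightarrow> (real \<Rightarrow> real) set" where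
  "psi_preimage S K U = {f \<in> MSK S K 0. psi S K f \<in> I_upper S U}"

end

theory Submission imports Defs begin

text \<open>
  Let \<open>P\<close> be a prime ideal. If the indicator \<open>\<delta>\<^sub>n\<close> of some \<open>\<alpha>\<^sub>n\<close> is not in \<open>P\<close>, then
  \<open>|f| \<and> \<delta>\<^sub>n = 0\<close> for \<open>f(\<alpha>\<^sub>n) = 0\<close> forces \<open>P = M\<^bsub>\<alpha>\<^sub>n\<^esub>\<close>. Otherwise \<open>P\<close> contains all functions
  vanishing near \<open>0\<close>, so membership in \<open>P\<close> depends only on the germ at \<open>0\<close>; a germ with
  smallest exponent \<open>u\<close> lies between two multiples of \<open>t\<^sup>u\<close>, so \<open>P\<close> is determined by the
  upper set of all \<open>s\<close> with \<open>t\<^sup>s \<in> P\<close>. Conversely, germs are linearly ordered, hence each ideal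
  given by an upper set is prime: near \<open>0\<close>, \<open>inf x y\<close> coincides with \<open>x\<close> or with \<open>y\<close>.
\<close>

section \<open>Powers with rational exponents and their finite linear combinations\<close>

lemma rat_pow_nonneg: "0 \<le> rat_pow t s"
  by (simp add: rat_pow_def)

lemma rat_pow_pos: "0 < t \<Longrightarrow> 0 < rat_pow t s"
  by (simp add: rat_pow_def)

lemma rat_pow_zero_left: "rat_pow 0 s = (if s = 0 then 1 else 0)"
  by (simp add: rat_pow_def)

text \<open>Nonnegativity prevents cancellation of exponents: for \<open>b = - a\<close> with
  \<open>a\<close> nonzero, the left side at \<open>t = 0\<close> is 1 while the right side is
  0.\<close>

lemma rat_pow_add:
  assumes "0 \<le> a" "0 \<le> b"
  shows "rat_pow t (a + b) = rat_pow t a * rat_pow t b"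
  using assms by (auto simp: rat_pow_def of_rat_add powr_add add_nonneg_eq_0_iff)

lemma rat_pow_le_one:
  assumes "0 \<le> t" "t \<le> 1" "0 \<le> s"
  shows "rat_pow t s \<le> 1"
  using assms by (simp add: rat_pow_def powr_le1)

text \<open>Evaluation of a formal combination of powers. The type keeps exponents distinct and
  coefficients nonzero on the support, so that representations near 0 can be unique.\<close>

definition gen_poly :: "(rat \<Rightarrow>\<^sub>0 real) \<Rightarrow> real \<Rightarrow> real" where
  "gen_poly g t = (\<Sum>s\<in>Poly_Mapping.keys g. Poly_Mapping.lookup g s * rat_pow t s)"

lemma gen_poly_superset:
  assumes "finite A" "Poly_Mapping.keys g \<subseteq> A"
  shows "gen_poly g t = (\<Sum>s\<in>A. Poly_Mapping.lookup g s * rat_pow t s)"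
  unfolding gen_poly_def using assms
  by (intro sum.mono_neutral_left) (auto simp: in_keys_iff)

lemma gen_poly_zero [simp]: "gen_poly 0 t = 0"
  by (simp add: gen_poly_def)

lemma gen_poly_single [simp]: "gen_poly (Poly_Mapping.single s a) t = a * rat_pow t s"
  by (subst gen_poly_superset[of "{s}"]) auto

lemma gen_poly_add: "gen_poly (g + h) t = gen_poly g t + gen_poly h t"
proof -
  let ?A = "Poly_Mapping.keys g \<union> Poly_Mapping.keys h"
  have "gen_poly (g + h) t = (\<Sum>s\<in>?A. Poly_Mapping.lookup (g + h) s * rat_pow t s)"
    by (rule gen_poly_superset) (simp_all add: Poly_Mapping.keys_add)
  also have "\<dots> = (\<Sum>s\<in>?A. Poly_Mapping.lookup g s * rat_pow t s)
      + (\<Sum>s\<in>?A. Poly_Mapping.lookup h s * rat_pow t s)"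
    by (simp add: lookup_add distrib_right sum.distrib)
  also have "\<dots> = gen_poly g t + gen_poly h t"
    by (simp add: gen_poly_superset[of ?A])
  finally show ?thesis .
qed

lemma gen_poly_sum_single:
  assumes "finite A"
  shows "gen_poly (\<Sum>k\<in>A. Poly_Mapping.single (s k) (a k)) t = (\<Sum>k\<in>A. a k * rat_pow t (s k))"
  using assms by (induction A) (auto simp: gen_poly_add)

lemma keys_sum_single: "Poly_Mapping.keys (\<Sum>k\<in>A. Poly_Mapping.single (s k) (a k)) \<subseteq> s ` A"
  by (rule order_trans[OF Poly_Mapping.keys_sum]) auto

lemma gen_poly_scale:
  obtains h where "Poly_Mapping.keys h \<subseteq> Poly_Mapping.keys g" "\<And>t. gen_poly h t = c * gen_poly g t"
proof
  let ?h = "\<Sum>s\<in>Poly_Mapping.keys g. Poly_Mapping.single s (c * Poly_Mapping.lookup g s)"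
  show "Poly_Mapping.keys ?h \<subseteq> Poly_Mapping.keys g"
    using keys_sum_single[of "\<lambda>s. s"] by simp
  show "gen_poly ?h t = c * gen_poly g t" for t
    by (subst gen_poly_sum_single[where s = "\<lambda>s. s"])
      (simp_all add: gen_poly_def sum_distrib_left mult.assoc)
qed

text \<open>Enumerating the support leads back to the indexed sums in the definitions of
  \<open>RSK\<close> and \<open>psi\<close>.\<close>

lemma poly_mapping_eq_sum_single:
  fixes g :: "'a \<Rightarrow>\<^sub>0 'b::comm_monoid_add"
  shows "\<exists>n s a. s ` {..<n::nat} \<subseteq> Poly_Mapping.keys g
    \<and> g = (\<Sum>k<n. Poly_Mapping.single (s k) (a k))"
proof -
  obtain s where s: "bij_betw s {0..<card (Poly_Mapping.keys g)} (Poly_Mapping.keys g)"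
    using ex_bij_betw_nat_finite[OF finite_keys] by blast
  then have s': "bij_betw s {..<card (Poly_Mapping.keys g)} (Poly_Mapping.keys g)"
    by (simp add: atLeast0LessThan)
  have "g = (\<Sum>x\<in>Poly_Mapping.keys g. Poly_Mapping.single x (Poly_Mapping.lookup g x))"
    by (rule poly_mapping_eqI)
      (auto simp: lookup_sum lookup_single when_def in_keys_iff)
  also have "\<dots> = (\<Sum>k<card (Poly_Mapping.keys g).
      Poly_Mapping.single (s k) (Poly_Mapping.lookup g (s k)))"
    by (rule sum.reindex_bij_betw[OF s', symmetric])
  finally show ?thesis
    using s' by (metis bij_betw_imp_surj_on order_refl)
qed

lemma linear_subspace_sum:
  assumes "linear_subspace E I" "finite A" "\<And>i. i \<in> A \<Longrightarrow> f i \<in> I"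
  shows "(\<lambda>t. \<Sum>i\<in>A. c i * f i t) \<in> I"
  using assms(2,3)
proof (induction A)
  case empty
  then show ?case using assms(1) by (simp add: linear_subspace_def)
next
  case (insert i A)
  then have "(\<lambda>t. c i * f i t) \<in> I" "(\<lambda>t. \<Sum>i\<in>A. c i * f i t) \<in> I"
    using assms(1) by (auto simp: linear_subspace_def)
  then have "(\<lambda>t. c i * f i t + (\<Sum>i\<in>A. c i * f i t)) \<in> I"
    using assms(1) unfolding linear_subspace_def by fast
  then show ?case using insert by simp
qed

lemma order_idealD:
  assumes "order_ideal E I" "x \<in> E" "y \<in> I" "\<And>t. \<bar>x t\<bar> \<le> \<bar>y t\<bar>"
  shows "x \<in> I"
  using assms unfolding order_ideal_def by blast

section \<open>Germs at 0 along the null sequence\<close>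

locale null_sequence =
  fixes \<alpha> :: "nat \<Rightarrow> real" and K :: "real set" and S :: "rat set"
  assumes decreasing: "\<And>m n. m < n \<Longrightarrow> \<alpha> n < \<alpha> m"
    and null: "\<alpha> \<longlonglongrightarrow> 0"
    and K: "K = {\<alpha> n | n. True} \<union> {0}"
    and S: "S \<subseteq> {s. 0 < s}"
begin

text \<open>In contrast to \<open>at 0 within K\<close>, this filter includes the point \<open>0\<close> itself.\<close>

definition near :: "real filter" where
  "near = inf (nhds 0) (principal K)"

text \<open>By uniqueness of representations, \<open>germs U\<close> is \<open>R\<^sub>S(K)\<close> for \<open>U = S \<union> {0}\<close>, it is \<open>M\<^sub>0\<close>
  for \<open>U = S\<close>, and it is \<open>\<psi>\<^sup>-\<^sup>1(I\<^sub>U)\<close> for an upper set \<open>U\<close> of \<open>S\<close>.\<close>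

definition germs :: "rat set \<Rightarrow> (real \<Rightarrow> real) set" where
  "germs U = {f. (\<forall>t. t \<notin> K \<longrightarrow> f t = 0)
     \<and> (\<exists>g. Poly_Mapping.keys g \<subseteq> U \<and> (\<forall>\<^sub>F t in near. f t = gen_poly g t))}"

text \<open>Cut off outside \<open>K\<close> to respect the extension by 0;
  \<open>monomial 0\<close> is the constant function 1 on \<open>K\<close>.\<close>

definition monomial :: "rat \<Rightarrow> real \<Rightarrow> real" where
  "monomial s t = (if t \<in> K then rat_pow t s else 0)"

definition point :: "nat \<Rightarrow> real \<Rightarrow> real" where
  "point n t = (if t = \<alpha> n then 1 else 0)"

lemma germsI:
  assumes "\<And>t. t \<notin> K \<Longrightarrow> f t = 0" "Poly_Mapping.keys g \<subseteq> U" "\<forall>\<^sub>F t in near. f t = gen_poly g t"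
  shows "f \<in> germs U"
  using assms by (auto simp: germs_def)

lemma germsE:
  assumes "f \<in> germs U"
  obtains g where "\<And>t. t \<notin> K \<Longrightarrow> f t = 0" "Poly_Mapping.keys g \<subseteq> U"
    "\<forall>\<^sub>F t in near. f t = gen_poly g t"
  using assms by (auto simp: germs_def)

lemma germs_mono: "U \<subseteq> V \<Longrightarrow> germs U \<subseteq> germs V"
  by (auto simp: germs_def)

lemma alpha_pos: "0 < \<alpha> n"
proof -
  \<comment> \<open>The limit yields only a weak inequality; using it at the next index makes it
    strict at \<open>n\<close>.\<close>
  have "0 \<le> \<alpha> (Suc n)"
  proof (rule LIMSEQ_le_const2[OF null])
    show "\<exists>N. \<forall>m\<ge>N. \<alpha> m \<le> \<alpha> (Suc n)"
      using decreasing by (metis le_less order_refl)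
  qed
  then show ?thesis using decreasing[of n "Suc n"] by simp
qed

lemma alpha_eq_iff [simp]: "\<alpha> m = \<alpha> n \<longleftrightarrow> m = n"
  by (metis decreasing less_irrefl linorder_neqE_nat)

lemma alpha_in_K [simp]: "\<alpha> n \<in> K" and zero_in_K [simp]: "0 \<in> K"
  by (auto simp: K)

lemma K_cases:
  assumes "t \<in> K"
  obtains "t = 0" | n where "t = \<alpha> n"
  using assms by (auto simp: K)

lemma K_nonneg: "t \<in> K \<Longrightarrow> 0 \<le> t"
  using alpha_pos by (auto simp: K less_imp_le)

text \<open>Translates between the filter and the explicit \<epsilon> of the definitions. The
  interval may start at 0 because \<open>K\<close> has no negative points.\<close>

lemma eventually_near_iff:
  "(\<forall>\<^sub>F t in near. P t) \<longleftrightarrow> (\<exists>\<epsilon>>0. \<forall>t\<in>{0..<\<epsilon>} \<inter> K. P t)"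
  unfolding near_def eventually_inf_principal eventually_nhds_metric
  using K_nonneg by (fastforce simp: dist_real_def)

lemma eventually_near_in_K: "\<forall>\<^sub>F t in near. t \<in> K"
  by (simp add: near_def eventually_inf_principal)

lemma eventually_near_zero: "(\<forall>\<^sub>F t in near. P t) \<Longrightarrow> P 0"
  by (auto simp: eventually_near_iff)

lemma eventually_near_sequentially:
  assumes "\<forall>\<^sub>F t in near. P t"
  shows "\<forall>\<^sub>F n in sequentially. P (\<alpha> n)"
proof -
  have "filterlim \<alpha> near sequentially"
    unfolding near_def filterlim_inf filterlim_principal using null by simp
  then show ?thesis using assms by (simp add: filterlim_iff)
qed

lemma tendsto_rat_pow_near:
  assumes "0 \<le> s"
  shows "((\<lambda>t. rat_pow t s) \<longlongrightarrow> rat_pow 0 s) near"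
proof (cases "s = 0")
  case False
  have "((\<lambda>t. t) \<longlongrightarrow> 0) near"
    unfolding near_def by (rule tendsto_mono[OF inf_le1]) (rule filterlim_ident)
  moreover have "\<forall>\<^sub>F t in near. 0 \<le> t"
    using eventually_near_in_K by eventually_elim (rule K_nonneg)
  ultimately have "((\<lambda>t. t powr of_rat s) \<longlongrightarrow> 0 powr of_rat s) near"
    using assms False by (intro tendsto_powr') auto
  then show ?thesis using False by (simp add: rat_pow_def)
qed (simp add: rat_pow_def)

section \<open>Leading terms and uniqueness of representations\<close>

text \<open>After division by t^u all exponents are nonnegative, so the quotient converges to its
  value at 0, where only exponent \<open>u\<close> contributes. If \<open>u\<close> is not in the
  support, the limit is 0.\<close>

lemma gen_poly_factor:
  assumes "0 \<le> u" "\<And>s. s \<in> Poly_Mapping.keys g \<Longrightarrow> u \<le> s"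
  obtains q where "(q \<longlongrightarrow> Poly_Mapping.lookup g u) near" "\<And>t. gen_poly g t = rat_pow t u * q t"
proof
  let ?q = "\<lambda>t. \<Sum>s\<in>Poly_Mapping.keys g. Poly_Mapping.lookup g s * rat_pow t (s - u)"
  have "(?q \<longlongrightarrow> ?q 0) near"
    using assms by (intro tendsto_sum tendsto_mult tendsto_const tendsto_rat_pow_near) auto
  moreover have "?q 0 = (\<Sum>s\<in>Poly_Mapping.keys g. if s = u then Poly_Mapping.lookup g u else 0)"
    by (intro sum.cong) (auto simp: rat_pow_zero_left)
  ultimately show "(?q \<longlongrightarrow> Poly_Mapping.lookup g u) near"
    by (simp add: in_keys_iff split: if_splits)
  have "rat_pow t s = rat_pow t u * rat_pow t (s - u)" if "s \<in> Poly_Mapping.keys g" for s t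
    using rat_pow_add[of u "s - u" t] assms that by simp
  then show "gen_poly g t = rat_pow t u * ?q t" for t
    unfolding gen_poly_def sum_distrib_left by (intro sum.cong) (auto simp: algebra_simps)
qed

lemma gen_poly_factor_Min:
  assumes "g \<noteq> 0" "\<And>s. s \<in> Poly_Mapping.keys g \<Longrightarrow> 0 \<le> s"
  shows "\<exists>u q. u \<in> Poly_Mapping.keys g \<and> (\<forall>s\<in>Poly_Mapping.keys g. u \<le> s)
    \<and> (q \<longlongrightarrow> Poly_Mapping.lookup g u) near \<and> (\<forall>t. gen_poly g t = rat_pow t u * q t)"
proof -
  let ?u = "Min (Poly_Mapping.keys g)"
  have u: "?u \<in> Poly_Mapping.keys g" "\<And>s. s \<in> Poly_Mapping.keys g \<Longrightarrow> ?u \<le> s"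
    using assms(1) by auto
  obtain q where "(q \<longlongrightarrow> Poly_Mapping.lookup g ?u) near" "\<And>t. gen_poly g t = rat_pow t ?u * q t"
    by (rule gen_poly_factor[OF assms(2)[OF u(1)] u(2)]) auto
  then show ?thesis using u by blast
qed

text \<open>Otherwise every exponent of \<open>h\<close> exceeds the smallest exponent u of
  \<open>g\<close>. Divided by t^u, the left side tends to the modulus of a nonzero leading
  coefficient and the right side to 0.\<close>

lemma keys_dominated:
  assumes le: "\<forall>\<^sub>F t in near. \<bar>gen_poly g t\<bar> \<le> \<bar>gen_poly h t\<bar>"
    and g: "\<And>s. s \<in> Poly_Mapping.keys g \<Longrightarrow> 0 \<le> s"
    and s: "s \<in> Poly_Mapping.keys g"
  shows "\<exists>s'\<in>Poly_Mapping.keys h. s' \<le> s"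
proof (rule ccontr)
  assume *: "\<not> ?thesis"
  have "g \<noteq> 0" using s by auto
  then obtain u q where u: "u \<in> Poly_Mapping.keys g" "\<And>s. s \<in> Poly_Mapping.keys g \<Longrightarrow> u \<le> s"
    and q: "(q \<longlongrightarrow> Poly_Mapping.lookup g u) near" "\<And>t. gen_poly g t = rat_pow t u * q t"
    using gen_poly_factor_Min[OF _ g] by metis
  have lt: "u < s'" if "s' \<in> Poly_Mapping.keys h" for s'
    using * that u(2)[OF s] by force
  then have "Poly_Mapping.lookup h u = 0"
    by (metis in_keys_iff less_irrefl)
  moreover obtain r where "(r \<longlongrightarrow> Poly_Mapping.lookup h u) near" "\<And>t. gen_poly h t = rat_pow t u * r t"
    using gen_poly_factor[of u h] lt g[OF u(1)] by (metis less_imp_le)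
  ultimately have r: "(r \<longlongrightarrow> 0) near" "\<And>t. gen_poly h t = rat_pow t u * r t"
    by auto
  \<comment> \<open>The filter \<open>near\<close> includes 0, where t^u may vanish. At the points
    \<open>\<alpha> n\<close> this factor is positive and can be cancelled.\<close>
  have lim: "filterlim \<alpha> near sequentially"
    using eventually_near_sequentially by (simp add: filterlim_iff)
  have "\<forall>\<^sub>F n in sequentially. \<bar>q (\<alpha> n)\<bar> \<le> \<bar>r (\<alpha> n)\<bar>"
    using eventually_near_sequentially[OF le]
  proof eventually_elim
    case (elim n)
    then show ?case
      using rat_pow_pos[OF alpha_pos, of n u] by (simp add: q(2) r(2) abs_mult)
  qed
  then have "\<bar>Poly_Mapping.lookup g u\<bar> \<le> \<bar>0\<bar>"
    using filterlim_compose[OF q(1) lim] filterlim_compose[OF r(1) lim]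
    by (intro tendsto_le[OF sequentially_bot]) (auto intro!: tendsto_rabs_zero tendsto_rabs)
  then show False using u(1) by (simp add: in_keys_iff)
qed

text \<open>The difference is dominated by 0, so by \<open>keys_dominated\<close> an exponent of it
  would lie above an exponent of the zero combination, which has none.\<close>

lemma gen_poly_unique:
  assumes eq: "\<forall>\<^sub>F t in near. gen_poly g t = gen_poly h t"
    and "\<And>s. s \<in> Poly_Mapping.keys g \<Longrightarrow> 0 \<le> s" "\<And>s. s \<in> Poly_Mapping.keys h \<Longrightarrow> 0 \<le> s"
  shows "g = h"
proof -
  have "\<forall>\<^sub>F t in near. \<bar>gen_poly (g - h) t\<bar> \<le> \<bar>gen_poly 0 t\<bar>"
    using eq
  proof eventually_elim
    case (elim t)
    then show ?case using gen_poly_add[of "g - h" h t] by simp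
  qed
  moreover have "0 \<le> s" if "s \<in> Poly_Mapping.keys (g - h)" for s
    using that assms(2,3) keys_diff[of g h] by blast
  ultimately have "Poly_Mapping.keys (g - h) = {}"
    using keys_dominated[of "g - h" 0] by force
  then show ?thesis by simp
qed

text \<open>Near 0 the sign is that of the leading coefficient, as in the order of Lex(S).\<close>

lemma gen_poly_sign:
  assumes "\<And>s. s \<in> Poly_Mapping.keys g \<Longrightarrow> 0 \<le> s"
  shows "(\<forall>\<^sub>F t in near. 0 \<le> gen_poly g t) \<or> (\<forall>\<^sub>F t in near. gen_poly g t \<le> 0)"
proof (cases "g = 0")
  case False
  obtain u q where u: "u \<in> Poly_Mapping.keys g" "\<And>s. s \<in> Poly_Mapping.keys g \<Longrightarrow> u \<le> s"
    and q: "(q \<longlongrightarrow> Poly_Mapping.lookup g u) near" "\<And>t. gen_poly g t = rat_pow t u * q t"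
    using gen_poly_factor_Min[OF False assms] by metis
  show ?thesis
  proof (cases "0::real" "Poly_Mapping.lookup g u" rule: linorder_cases)
    case less
    from order_tendstoD(1)[OF q(1) this] have "\<forall>\<^sub>F t in near. 0 \<le> gen_poly g t"
      by eventually_elim (simp add: q(2) rat_pow_nonneg)
    then show ?thesis ..
  next
    case greater
    from order_tendstoD(2)[OF q(1) this] have "\<forall>\<^sub>F t in near. gen_poly g t \<le> 0"
      by eventually_elim (simp add: q(2) rat_pow_nonneg mult_nonneg_nonpos)
    then show ?thesis ..
  qed (use u(1) in \<open>simp add: in_keys_iff\<close>)
qed simp

section \<open>Identification of the function spaces with spaces of germs\<close>

text \<open>Each \<open>\<alpha> n\<close> is isolated in \<open>K\<close>, so only continuity at 0
  depends on the germ.\<close>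

lemma continuous_on_germ:
  assumes eq: "\<forall>\<^sub>F t in near. f t = gen_poly g t" and g: "\<And>s. s \<in> Poly_Mapping.keys g \<Longrightarrow> 0 \<le> s"
  shows "continuous_on K f"
  unfolding continuous_on_def
proof
  fix x assume "x \<in> K"
  then show "(f \<longlongrightarrow> f x) (at x within K)"
  proof (cases rule: K_cases)
    case 1
    have "(gen_poly g \<longlongrightarrow> gen_poly g 0) near"
      unfolding gen_poly_def using g
      by (intro tendsto_sum tendsto_mult tendsto_const tendsto_rat_pow_near)
    then have "(f \<longlongrightarrow> f 0) near"
      using eventually_near_zero[OF eq] tendsto_cong[OF eq] by simp
    moreover have "at 0 within K \<le> near"
      unfolding at_within_def near_def by (intro inf_mono) auto
    ultimately show ?thesis using 1 by (auto intro: tendsto_mono)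
  next
    case (2 n)
    \<comment> \<open>The distances to all larger terms and to the next smaller one; the remaining
      terms and 0 are farther away than the latter.\<close>
    let ?A = "(\<lambda>m. \<alpha> m - \<alpha> n) ` {..<n} \<union> {\<alpha> n - \<alpha> (Suc n)}"
    have d: "0 < Min ?A"
      using decreasing by (subst Min_gr_iff) auto
    have isolated: "y = \<alpha> n" if "y \<in> K" "dist y (\<alpha> n) < Min ?A" for y
    proof (rule ccontr)
      assume ne: "y \<noteq> \<alpha> n"
      have less: "dist y (\<alpha> n) < a" if "a \<in> ?A" for a
        using \<open>dist y (\<alpha> n) < Min ?A\<close> that by (subst (asm) Min_gr_iff) auto
      have "\<alpha> (Suc n) < y" using less[of "\<alpha> n - \<alpha> (Suc n)"] by (auto simp: dist_real_def)
      moreover from this alpha_pos[of "Suc n"] have "y \<noteq> 0" by simp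
      with \<open>y \<in> K\<close> obtain m where m: "y = \<alpha> m" by (auto elim: K_cases)
      ultimately have "m < n"
        using decreasing[of "Suc n" m] ne by (metis less_asym not_less_less_Suc_eq not_less_iff_gr_or_eq)
      then show False using less[of "\<alpha> m - \<alpha> n"] m by (auto simp: dist_real_def)
    qed
    have "\<forall>\<^sub>F y in at (\<alpha> n) within K. f y = f (\<alpha> n)"
      unfolding eventually_at using d isolated by blast
    then show ?thesis using 2 by (simp add: tendsto_eventually)
  qed
qed

lemma RSK_eq_germs: "RSK S K = germs (insert 0 S)"
proof (intro set_eqI iffI)
  fix f assume "f \<in> RSK S K"
  then obtain n :: nat and s a where f: "f \<in> CK K" and s: "\<forall>k\<le>n. s k \<in> S \<union> {0}"
    and eq: "\<forall>\<^sub>F t in near. f t = (\<Sum>k\<le>n. a k * rat_pow t (s k))"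
    unfolding RSK_def eventually_near_iff by blast
  show "f \<in> germs (insert 0 S)"
  proof (rule germsI)
    show "f t = 0" if "t \<notin> K" for t using f that by (simp add: CK_def)
    show "Poly_Mapping.keys (\<Sum>k\<in>{..n}. Poly_Mapping.single (s k) (a k)) \<subseteq> insert 0 S"
      by (rule order_trans[OF keys_sum_single]) (use s in auto)
    show "\<forall>\<^sub>F t in near. f t = gen_poly (\<Sum>k\<in>{..n}. Poly_Mapping.single (s k) (a k)) t"
      using eq by (simp add: gen_poly_sum_single)
  qed
next
  fix f assume "f \<in> germs (insert 0 S)"
  then obtain g where off: "\<And>t. t \<notin> K \<Longrightarrow> f t = 0" and g: "Poly_Mapping.keys g \<subseteq> insert 0 S"
    and eq: "\<forall>\<^sub>F t in near. f t = gen_poly g t" by (rule germsE) blast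
  have "continuous_on K f" using g S by (intro continuous_on_germ[OF eq]) force
  then have f: "f \<in> CK K" using off by (simp add: CK_def)
  obtain n :: nat and s a where s: "s ` {..<n} \<subseteq> Poly_Mapping.keys g"
    and sum: "g = (\<Sum>k<n. Poly_Mapping.single (s k) (a k))"
    using poly_mapping_eq_sum_single[of g] by metis
  \<comment> \<open>Sums in \<open>RSK\<close> have at least one term. A term with coefficient 0 and
    the always admissible exponent 0 is added at index \<open>n\<close>, which also covers an empty
    support.\<close>
  have "\<forall>\<^sub>F t in near. f t = (\<Sum>k\<le>n. (a(n := 0)) k * rat_pow t ((s(n := 0)) k))"
    using eq unfolding sum gen_poly_sum_single[OF finite_lessThan]
    by (simp add: lessThan_Suc_atMost[symmetric])
  moreover have "\<forall>k\<le>n. (s(n := 0)) k \<in> S \<union> {0}"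
    using s g by (auto simp: le_less)
  ultimately show "f \<in> RSK S K"
    using f unfolding RSK_def eventually_near_iff by blast
qed

text \<open>Only the constant term survives at 0. Hence vanishing at 0 means that exponent 0 is
  absent, which distinguishes \<open>MSK S K 0\<close> from \<open>RSK S K\<close>.\<close>

lemma germ_value_zero:
  assumes "\<forall>\<^sub>F t in near. f t = gen_poly g t"
  shows "f 0 = Poly_Mapping.lookup g 0"
proof -
  have "f 0 = (\<Sum>s\<in>Poly_Mapping.keys g. if s = 0 then Poly_Mapping.lookup g 0 else 0)"
    unfolding eventually_near_zero[OF assms] gen_poly_def
    by (intro sum.cong) (auto simp: rat_pow_zero_left)
  then show ?thesis by (simp add: in_keys_iff split: if_splits)
qed

lemma MSK_zero_eq_germs: "MSK S K 0 = germs S"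
proof (intro set_eqI iffI)
  fix f assume "f \<in> MSK S K 0"
  then have "f \<in> germs (insert 0 S)" and f0: "f 0 = 0"
    by (auto simp: MSK_def RSK_eq_germs)
  then obtain g where off: "\<And>t. t \<notin> K \<Longrightarrow> f t = 0" and g: "Poly_Mapping.keys g \<subseteq> insert 0 S"
    and eq: "\<forall>\<^sub>F t in near. f t = gen_poly g t" by (auto elim: germsE)
  have "0 \<notin> Poly_Mapping.keys g" using germ_value_zero[OF eq] f0 by (simp add: in_keys_iff)
  then show "f \<in> germs S" using off g eq by (intro germsI[where g = g]) auto
next
  fix f assume f: "f \<in> germs S"
  then obtain g where g: "Poly_Mapping.keys g \<subseteq> S"
    and eq: "\<forall>\<^sub>F t in near. f t = gen_poly g t" by (auto elim: germsE)
  have "f 0 = 0" using germ_value_zero[OF eq] g S by (force simp: in_keys_iff)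
  then show "f \<in> MSK S K 0"
    using f germs_mono[of S "insert 0 S"] by (auto simp: MSK_def RSK_eq_germs)
qed

text \<open>Shows that the definite description in \<open>psi\<close> denotes: existence by
  enumerating the support, uniqueness by \<open>gen_poly_unique\<close>.\<close>

lemma psi_eqI:
  assumes g: "Poly_Mapping.keys g \<subseteq> S" and eq: "\<forall>\<^sub>F t in near. f t = gen_poly g t"
  shows "psi S K f = g"
  unfolding psi_def
proof (rule the_equality)
  obtain n :: nat and s a where "s ` {..<n} \<subseteq> Poly_Mapping.keys g"
    and sum: "g = (\<Sum>k<n. Poly_Mapping.single (s k) (a k))"
    using poly_mapping_eq_sum_single[of g] by metis
  then have "\<forall>k<n. s k \<in> S" using g by auto
  moreover have "\<forall>\<^sub>F t in near. f t = (\<Sum>k<n. a k * rat_pow t (s k))"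
    using eq unfolding sum gen_poly_sum_single[OF finite_lessThan] .
  then obtain \<epsilon> where "\<epsilon> > 0" "\<forall>t\<in>{0..<\<epsilon>} \<inter> K. f t = (\<Sum>k<n. a k * rat_pow t (s k))"
    unfolding eventually_near_iff by blast
  ultimately show "\<exists>\<epsilon>>0. \<exists>n::nat. \<exists>s a. (\<forall>k<n. s k \<in> S)
     \<and> (\<forall>t\<in>{0..<\<epsilon>} \<inter> K. f t = (\<Sum>k<n. a k * rat_pow t (s k)))
     \<and> g = (\<Sum>k<n. Poly_Mapping.single (s k) (a k))" using sum by blast
next
  fix h
  assume "\<exists>\<epsilon>>0. \<exists>n::nat. \<exists>s a. (\<forall>k<n. s k \<in> S)
     \<and> (\<forall>t\<in>{0..<\<epsilon>} \<inter> K. f t = (\<Sum>k<n. a k * rat_pow t (s k)))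
     \<and> h = (\<Sum>k<n. Poly_Mapping.single (s k) (a k))"
  then obtain n :: nat and s a where s: "\<forall>k<n. s k \<in> S"
    and eq': "\<forall>\<^sub>F t in near. f t = (\<Sum>k<n. a k * rat_pow t (s k))"
    and h: "h = (\<Sum>k<n. Poly_Mapping.single (s k) (a k))"
    unfolding eventually_near_iff by blast
  have "\<forall>\<^sub>F t in near. gen_poly h t = gen_poly g t"
    using eq eq' unfolding h gen_poly_sum_single[OF finite_lessThan] by eventually_elim simp
  moreover have "Poly_Mapping.keys h \<subseteq> S"
    unfolding h by (rule order_trans[OF keys_sum_single]) (use s in auto)
  ultimately show "h = g"
    using g S by (intro gen_poly_unique) force+
qed

text \<open>Replaces \<open>psi\<close> by a condition on any one representation near 0, so that the
  ideals can be studied as germs.\<close>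

lemma psi_preimage_eq_germs:
  assumes "U \<subseteq> S"
  shows "psi_preimage S K U = germs U"
proof (intro set_eqI iffI)
  fix f assume f: "f \<in> psi_preimage S K U"
  then have "f \<in> germs S" by (simp add: psi_preimage_def MSK_zero_eq_germs)
  then obtain g where off: "\<And>t. t \<notin> K \<Longrightarrow> f t = 0" and g: "Poly_Mapping.keys g \<subseteq> S"
    and eq: "\<forall>\<^sub>F t in near. f t = gen_poly g t" by (auto elim: germsE)
  have "Poly_Mapping.keys g \<subseteq> U"
    using f psi_eqI[OF g eq] by (simp add: psi_preimage_def I_upper_def)
  then show "f \<in> germs U" using off eq by (auto intro: germsI)
next
  fix f assume f: "f \<in> germs U"
  then obtain g where g: "Poly_Mapping.keys g \<subseteq> U"
    and eq: "\<forall>\<^sub>F t in near. f t = gen_poly g t" by (auto elim: germsE)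
  have "psi S K f \<in> I_upper S U"
    using psi_eqI[OF _ eq] g assms by (auto simp: I_upper_def Lex_def)
  then show "f \<in> psi_preimage S K U"
    using f germs_mono[OF assms] by (auto simp: psi_preimage_def MSK_zero_eq_germs)
qed

section \<open>Monomials, point indicators and the lattice structure of germs\<close>

lemma monomial_in_germs: "s \<in> U \<Longrightarrow> monomial s \<in> germs U"
proof (rule germsI)
  show "\<forall>\<^sub>F t in near. monomial s t = gen_poly (Poly_Mapping.single s 1) t"
    using eventually_near_in_K by eventually_elim (simp add: monomial_def)
qed (auto simp: monomial_def)

text \<open>By uniqueness of representations, \<open>U\<close> can be read off from
  \<open>germs U\<close>; this gives properness and distinctness of these ideals.\<close>

lemma monomial_in_germs_iff:
  assumes "0 \<le> s" "U \<subseteq> {s. 0 \<le> s}"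
  shows "monomial s \<in> germs U \<longleftrightarrow> s \<in> U"
proof
  assume "monomial s \<in> germs U"
  then obtain g where g: "Poly_Mapping.keys g \<subseteq> U"
    and eq: "\<forall>\<^sub>F t in near. monomial s t = gen_poly g t" by (auto elim: germsE)
  have "\<forall>\<^sub>F t in near. gen_poly (Poly_Mapping.single s 1) t = gen_poly g t"
    using eventually_near_in_K eq by eventually_elim (simp add: monomial_def)
  then have "Poly_Mapping.single s 1 = g"
    using assms g by (intro gen_poly_unique) (auto simp: subset_iff)
  then show "s \<in> U" using g by auto
qed (rule monomial_in_germs)

lemma eventually_zero_in_germs:
  assumes "\<And>t. t \<notin> K \<Longrightarrow> f t = 0" "\<forall>\<^sub>F t in near. f t = 0"
  shows "f \<in> germs U"
  using assms by (intro germsI[where g = 0]) auto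

lemma point_in_germs: "point n \<in> germs U"
proof (rule eventually_zero_in_germs)
  show "\<forall>\<^sub>F t in near. point n t = 0"
    unfolding eventually_near_iff
    \<comment> \<open>With \<epsilon> equal to \<open>\<alpha> n\<close>, the half-open interval
      just excludes the point carrying the indicator.\<close>
    by (rule exI[of _ "\<alpha> n"]) (auto simp: point_def alpha_pos)
qed (auto simp: point_def)

lemma linear_subspace_germs:
  assumes "U \<subseteq> V"
  shows "linear_subspace (germs V) (germs U)"
  unfolding linear_subspace_def
proof (intro conjI ballI allI)
  show "germs U \<subseteq> germs V" using assms by (rule germs_mono)
  show "(\<lambda>_. 0) \<in> germs U" by (simp add: eventually_zero_in_germs)
next
  fix f g assume "f \<in> germs U" "g \<in> germs U"
  then obtain p q where "Poly_Mapping.keys p \<subseteq> U" "Poly_Mapping.keys q \<subseteq> U"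
    and off: "\<And>t. t \<notin> K \<Longrightarrow> f t = 0" "\<And>t. t \<notin> K \<Longrightarrow> g t = 0"
    and eq: "\<forall>\<^sub>F t in near. f t = gen_poly p t" "\<forall>\<^sub>F t in near. g t = gen_poly q t"
    by (auto elim!: germsE)
  then have "Poly_Mapping.keys (p + q) \<subseteq> U" using Poly_Mapping.keys_add[of p q] by blast
  moreover have "\<forall>\<^sub>F t in near. f t + g t = gen_poly (p + q) t"
    using eq by eventually_elim (simp add: gen_poly_add)
  ultimately show "(\<lambda>t. f t + g t) \<in> germs U" using off by (intro germsI) auto
next
  fix c f assume "f \<in> germs U"
  then obtain g where g: "Poly_Mapping.keys g \<subseteq> U" and off: "\<And>t. t \<notin> K \<Longrightarrow> f t = 0"
    and eq: "\<forall>\<^sub>F t in near. f t = gen_poly g t" by (auto elim: germsE)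
  obtain h where "Poly_Mapping.keys h \<subseteq> Poly_Mapping.keys g" "\<And>t. gen_poly h t = c * gen_poly g t"
    using gen_poly_scale by blast
  moreover from this eq have "\<forall>\<^sub>F t in near. c * f t = gen_poly h t"
    by (auto elim: eventually_mono)
  ultimately show "(\<lambda>t. c * f t) \<in> germs U" using off g by (intro germsI[where g = h]) auto
qed

lemma germs_diff_scale:
  assumes "f \<in> germs U" "g \<in> germs U"
  shows "(\<lambda>t. f t - c * g t) \<in> germs U"
proof -
  have "(\<lambda>t. (- c) * g t) \<in> germs U" "\<forall>f\<in>germs U. \<forall>g\<in>germs U. (\<lambda>t. f t + g t) \<in> germs U"
    using linear_subspace_germs[of U U] assms(2) unfolding linear_subspace_def by blast+
  from this(2)[rule_format, OF assms(1) this(1)] show ?thesis by simp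
qed

text \<open>Germs are totally ordered because the difference has a constant sign near 0. Closure
  under modulus and primality both rest on this.\<close>

lemma germs_eventually_le:
  assumes U: "U \<subseteq> {s. 0 \<le> s}" and "f \<in> germs U" "g \<in> germs U"
  shows "(\<forall>\<^sub>F t in near. f t \<le> g t) \<or> (\<forall>\<^sub>F t in near. g t \<le> f t)"
proof -
  have "(\<lambda>t. f t - 1 * g t) \<in> germs U" using assms by (intro germs_diff_scale)
  then obtain p where p: "Poly_Mapping.keys p \<subseteq> U"
    and eq: "\<forall>\<^sub>F t in near. f t - 1 * g t = gen_poly p t" by (auto elim: germsE)
  have "(\<forall>\<^sub>F t in near. 0 \<le> gen_poly p t) \<or> (\<forall>\<^sub>F t in near. gen_poly p t \<le> 0)"
    using p U by (intro gen_poly_sign) auto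
  then show ?thesis
  proof
    assume "\<forall>\<^sub>F t in near. 0 \<le> gen_poly p t"
    with eq have "\<forall>\<^sub>F t in near. g t \<le> f t" by eventually_elim simp
    then show ?thesis ..
  next
    assume "\<forall>\<^sub>F t in near. gen_poly p t \<le> 0"
    with eq have "\<forall>\<^sub>F t in near. f t \<le> g t" by eventually_elim simp
    then show ?thesis ..
  qed
qed

lemma germs_cong:
  assumes "f \<in> germs U" "\<forall>\<^sub>F t in near. f t = h t" "\<And>t. t \<notin> K \<Longrightarrow> h t = 0"
  shows "h \<in> germs U"
proof -
  obtain g where g: "Poly_Mapping.keys g \<subseteq> U" and eq: "\<forall>\<^sub>F t in near. f t = gen_poly g t"
    using assms(1) by (auto elim: germsE)
  show ?thesis
  proof (rule germsI)
    show "\<forall>\<^sub>F t in near. h t = gen_poly g t" using eq assms(2) by eventually_elim simp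
  qed (use g assms(3) in auto)
qed

lemma germs_off: "f \<in> germs U \<Longrightarrow> t \<notin> K \<Longrightarrow> f t = 0"
  by (auto simp: germs_def)

lemma germs_scale: "f \<in> germs U \<Longrightarrow> (\<lambda>t. c * f t) \<in> germs U"
  using linear_subspace_germs[of U U] unfolding linear_subspace_def by blast

lemma germs_zero: "(\<lambda>_. 0) \<in> germs U"
  by (simp add: eventually_zero_in_germs)

lemma germs_abs:
  assumes U: "U \<subseteq> {s. 0 \<le> s}" and f: "f \<in> germs U"
  shows "(\<lambda>t. \<bar>f t\<bar>) \<in> germs U"
  using germs_eventually_le[OF U f germs_zero]
proof
  assume "\<forall>\<^sub>F t in near. f t \<le> 0"
  then have "\<forall>\<^sub>F t in near. - 1 * f t = \<bar>f t\<bar>" by eventually_elim simp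
  then show ?thesis by (rule germs_cong[OF germs_scale[OF f]]) (simp add: germs_off[OF f])
next
  assume "\<forall>\<^sub>F t in near. 0 \<le> f t"
  then have "\<forall>\<^sub>F t in near. f t = \<bar>f t\<bar>" by eventually_elim simp
  then show ?thesis by (rule germs_cong[OF f]) (simp add: germs_off[OF f])
qed

text \<open>By \<open>keys_dominated\<close>, each exponent of the smaller function lies above an
  exponent of the larger one, hence in the upper set.\<close>

lemma order_ideal_germs:
  assumes U: "U \<subseteq> V" and V: "V \<subseteq> {s. 0 \<le> s}" and upper: "\<And>u s. u \<in> U \<Longrightarrow> s \<in> V \<Longrightarrow> u \<le> s \<Longrightarrow> s \<in> U"
  shows "order_ideal (germs V) (germs U)"
  unfolding order_ideal_def
proof (intro conjI ballI impI linear_subspace_germs[OF U])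
  fix x y assume x: "x \<in> germs V" and y: "y \<in> germs U" and le: "\<forall>t. \<bar>x t\<bar> \<le> \<bar>y t\<bar>"
  obtain p where p: "Poly_Mapping.keys p \<subseteq> V" and xp: "\<forall>\<^sub>F t in near. x t = gen_poly p t"
    using x by (auto elim: germsE)
  obtain q where q: "Poly_Mapping.keys q \<subseteq> U" and yq: "\<forall>\<^sub>F t in near. y t = gen_poly q t"
    using y by (auto elim: germsE)
  have "\<forall>\<^sub>F t in near. \<bar>gen_poly p t\<bar> \<le> \<bar>gen_poly q t\<bar>"
    using xp yq by eventually_elim (use le in metis)
  then have "\<exists>s'\<in>Poly_Mapping.keys q. s' \<le> s" if "s \<in> Poly_Mapping.keys p" for s
    using p V that by (intro keys_dominated) auto
  then have "Poly_Mapping.keys p \<subseteq> U" using p q upper by blast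
  then show "x \<in> germs U" using xp germs_off[OF x] by (intro germsI)
qed

lemma insert_zero_S_nonneg: "insert 0 S \<subseteq> {s. 0 \<le> s}"
  using S by auto

section \<open>Prime ideals given by upper sets\<close>

lemma prime_order_ideal_germs:
  assumes U: "U \<in> upper_sets S"
  shows "prime_order_ideal (RSK S K) (germs U)"
  unfolding prime_order_ideal_def RSK_eq_germs
proof (intro conjI ballI impI)
  have US: "U \<subseteq> S" and upper: "\<And>u s. u \<in> U \<Longrightarrow> s \<in> S \<Longrightarrow> u \<le> s \<Longrightarrow> s \<in> U"
    using U by (auto simp: upper_sets_def)
  have pos: "0 < s" if "s \<in> U" for s using that US S by auto
  show "order_ideal (germs (insert 0 S)) (germs U)"
  \<comment> \<open>Upper sets of \<open>S\<close> remain upper in \<open>insert 0 S\<close>: all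
    their elements are positive, so 0 lies above none of them.\<close>
  proof (rule order_ideal_germs)
    show "s \<in> U" if "u \<in> U" "s \<in> insert 0 S" "u \<le> s" for u s
      using that upper pos[OF that(1)] by auto
  qed (use US S in auto)
  \<comment> \<open>The constant function 1 on \<open>K\<close> witnesses properness.\<close>
  have "monomial 0 \<notin> germs U"
    using pos by (subst monomial_in_germs_iff) (auto simp: less_imp_le)
  moreover have "monomial 0 \<in> germs (insert 0 S)" by (simp add: monomial_in_germs)
  ultimately show "germs U \<noteq> germs (insert 0 S)" by auto
next
  fix x y assume x: "x \<in> germs (insert 0 S)" and y: "y \<in> germs (insert 0 S)"
    and inf: "inf x y \<in> germs U"
  from germs_eventually_le[OF insert_zero_S_nonneg x y] show "x \<in> germs U \<or> y \<in> germs U"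
  proof
    assume "\<forall>\<^sub>F t in near. x t \<le> y t"
    then have "\<forall>\<^sub>F t in near. inf x y t = x t" by eventually_elim (simp add: inf_real_def)
    then show ?thesis using germs_cong[OF inf] germs_off[OF x] by blast
  next
    assume "\<forall>\<^sub>F t in near. y t \<le> x t"
    then have "\<forall>\<^sub>F t in near. inf x y t = y t" by eventually_elim (simp add: inf_real_def)
    then show ?thesis using germs_cong[OF inf] germs_off[OF y] by blast
  qed
qed

section \<open>Maximal ideals at the points of the sequence\<close>

lemma RSK_diff_scale: "f \<in> RSK S K \<Longrightarrow> g \<in> RSK S K \<Longrightarrow> (\<lambda>t. f t - c * g t) \<in> RSK S K"
  by (simp add: RSK_eq_germs germs_diff_scale)

lemma point_in_RSK: "point n \<in> RSK S K"
  by (simp add: RSK_eq_germs point_in_germs)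

text \<open>The indicators tell these ideals apart, and also separate them from every
  \<open>germs U\<close>, which contains all indicators.\<close>

lemma point_in_MSK_iff: "point m \<in> MSK S K (\<alpha> n) \<longleftrightarrow> m \<noteq> n"
  by (auto simp: MSK_def point_in_RSK) (auto simp: point_def)

lemma order_ideal_MSK: "order_ideal (RSK S K) (MSK S K t)"
proof -
  have "linear_subspace (RSK S K) (RSK S K)"
    by (simp add: RSK_eq_germs linear_subspace_germs)
  then have "linear_subspace (RSK S K) (MSK S K t)"
    by (auto simp: linear_subspace_def MSK_def)
  then show ?thesis
    by (auto simp: order_ideal_def MSK_def dest: spec[of _ t])
qed

lemma MSK_neq_RSK: "MSK S K (\<alpha> n) \<noteq> RSK S K"
  using point_in_MSK_iff[of n n] point_in_RSK[of n] by auto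

lemma prime_order_ideal_MSK: "prime_order_ideal (RSK S K) (MSK S K (\<alpha> n))"
  unfolding prime_order_ideal_def using order_ideal_MSK MSK_neq_RSK
  by (auto simp: MSK_def inf_real_def min_def split: if_splits)

text \<open>The kernel of evaluation at \<open>\<alpha> n\<close> has codimension one, so any
  function outside it generates the whole lattice together with it.\<close>

lemma maximal_order_ideal_MSK: "maximal_order_ideal (RSK S K) (MSK S K (\<alpha> n))"
  unfolding maximal_order_ideal_def
proof (intro conjI allI impI order_ideal_MSK MSK_neq_RSK)
  fix J assume J: "order_ideal (RSK S K) J \<and> MSK S K (\<alpha> n) \<subseteq> J \<and> J \<noteq> RSK S K"
  then have lin: "linear_subspace (RSK S K) J" by (simp add: order_ideal_def)
  then have JE: "J \<subseteq> RSK S K" by (simp add: linear_subspace_def)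
  show "J = MSK S K (\<alpha> n)"
  proof (rule ccontr)
    assume "J \<noteq> MSK S K (\<alpha> n)"
    then obtain f where f: "f \<in> J" "f (\<alpha> n) \<noteq> 0" using J JE by (auto simp: MSK_def)
    have "h \<in> J" if h: "h \<in> RSK S K" for h
    proof -
      let ?c = "h (\<alpha> n) / f (\<alpha> n)"
      have "(\<lambda>t. h t - ?c * f t) \<in> RSK S K" using h f JE by (intro RSK_diff_scale) auto
      then have "(\<lambda>t. h t - ?c * f t) \<in> J" using J f(2) by (auto simp: MSK_def)
      moreover have "(\<lambda>t. ?c * f t) \<in> J" using lin f(1) unfolding linear_subspace_def by blast
      ultimately have "(\<lambda>t. (h t - ?c * f t) + ?c * f t) \<in> J"
        using lin unfolding linear_subspace_def by fast
      then show ?thesis by simp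
    qed
    then show False using J JE by auto
  qed
qed

lemma prime_ideal_eq_MSK:
  assumes P: "prime_order_ideal (RSK S K) P" and n: "point n \<notin> P"
  shows "P = MSK S K (\<alpha> n)"
proof (intro set_eqI iffI)
  have ideal: "\<And>x y. x \<in> RSK S K \<Longrightarrow> y \<in> P \<Longrightarrow> (\<And>t. \<bar>x t\<bar> \<le> \<bar>y t\<bar>) \<Longrightarrow> x \<in> P"
    and lin: "linear_subspace (RSK S K) P"
    and prime: "\<And>x y. x \<in> RSK S K \<Longrightarrow> y \<in> RSK S K \<Longrightarrow> inf x y \<in> P \<Longrightarrow> x \<in> P \<or> y \<in> P"
    using P by (auto simp: prime_order_ideal_def order_ideal_def)
  {
    fix f assume f: "f \<in> P"
    then have fE: "f \<in> RSK S K" using lin by (auto simp: linear_subspace_def)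
    have "f (\<alpha> n) = 0"
    proof (rule ccontr)
      assume ne: "f (\<alpha> n) \<noteq> 0"
      \<comment> \<open>Normalised to the value 1 at \<open>\<alpha> n\<close>, the function
        dominates \<open>point n\<close> in modulus.\<close>
      have "(\<lambda>t. (1 / f (\<alpha> n)) * f t) \<in> P" using lin f unfolding linear_subspace_def by blast
      then have "point n \<in> P"
        by (rule ideal[OF point_in_RSK]) (use ne in \<open>auto simp: point_def\<close>)
      then show False using n by simp
    qed
    then show "f \<in> MSK S K (\<alpha> n)" using fE by (simp add: MSK_def)
  next
    fix f assume f: "f \<in> MSK S K (\<alpha> n)"
    then have fE: "f \<in> RSK S K" and f0: "f (\<alpha> n) = 0" by (auto simp: MSK_def)
    have absE: "(\<lambda>t. \<bar>f t\<bar>) \<in> RSK S K"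
      using fE germs_abs[OF insert_zero_S_nonneg] by (simp add: RSK_eq_germs)
    have "inf (\<lambda>t. \<bar>f t\<bar>) (point n) = (\<lambda>_. 0)"
      using f0 by (auto simp: fun_eq_iff point_def inf_real_def)
    then have "inf (\<lambda>t. \<bar>f t\<bar>) (point n) \<in> P" using lin by (simp add: linear_subspace_def)
    then have "(\<lambda>t. \<bar>f t\<bar>) \<in> P" using prime[OF absE point_in_RSK] n by blast
    then show "f \<in> P" by (rule ideal[OF fE]) simp
  }
qed

section \<open>Ideals containing all point indicators\<close>

text \<open>Only finitely many \<open>\<alpha> n\<close> lie outside a neighbourhood of 0, so such a
  function is a finite combination of indicators.\<close>

lemma eventually_zero_in_ideal:
  assumes lin: "linear_subspace E P" and points: "\<And>n. point n \<in> P"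
    and off: "\<And>t. t \<notin> K \<Longrightarrow> z t = 0" and ev: "\<forall>\<^sub>F t in near. z t = 0"
  shows "z \<in> P"
proof -
  obtain N where N: "\<And>n. n \<ge> N \<Longrightarrow> z (\<alpha> n) = 0"
    using eventually_near_sequentially[OF ev] by (auto simp: eventually_sequentially)
  have "z = (\<lambda>t. \<Sum>i\<in>{..<N}. z (\<alpha> i) * point i t)"
  proof
    fix t
    show "z t = (\<Sum>i\<in>{..<N}. z (\<alpha> i) * point i t)"
    proof (cases "\<exists>n. t = \<alpha> n")
      case True
      then obtain n where n: "t = \<alpha> n" ..
      have "(\<Sum>i\<in>{..<N}. z (\<alpha> i) * point i t) = (\<Sum>i\<in>{..<N}. if i = n then z (\<alpha> n) else 0)"
        by (intro sum.cong) (auto simp: n point_def)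
      then show ?thesis using N[of n] by (simp add: n split: if_splits)
    next
      case False
      then have "t = 0 \<or> t \<notin> K" by (auto elim: K_cases)
      then have "z t = 0" using off eventually_near_zero[OF ev] by auto
      then show ?thesis using False by (auto simp: point_def)
    qed
  qed
  moreover have "(\<lambda>t. \<Sum>i\<in>{..<N}. z (\<alpha> i) * point i t) \<in> P"
    using points by (intro linear_subspace_sum[OF lin]) auto
  ultimately show ?thesis by metis
qed

text \<open>Order ideals require domination everywhere. The part \<open>z\<close> of
  \<open>h\<close> on the points where the bound fails vanishes near 0, hence lies in
  \<open>P\<close>; the rest of \<open>h\<close> is dominated by \<open>C\<close> times
  \<open>f\<close> at every point.\<close>

lemma ideal_eventually_dominated:
  assumes P: "order_ideal (RSK S K) P" and points: "\<And>n. point n \<in> P"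
    and f: "f \<in> P" and h: "h \<in> RSK S K" and le: "\<forall>\<^sub>F t in near. \<bar>h t\<bar> \<le> C * \<bar>f t\<bar>"
  shows "h \<in> P"
proof -
  have lin: "linear_subspace (RSK S K) P" using P by (simp add: order_ideal_def)
  define z where "z t = (if \<bar>h t\<bar> \<le> C * \<bar>f t\<bar> then 0 else h t)" for t
  have ez: "\<forall>\<^sub>F t in near. z t = 0" using le by eventually_elim (simp add: z_def)
  have off: "z t = 0" if "t \<notin> K" for t
    using germs_off that h by (simp add: z_def RSK_eq_germs)
  have z: "z \<in> P" by (rule eventually_zero_in_ideal[OF lin points off ez])
  have "z \<in> RSK S K" using eventually_zero_in_germs[OF off ez] by (simp add: RSK_eq_germs)
  then have dE: "(\<lambda>t. h t - 1 * z t) \<in> RSK S K" using h by (intro RSK_diff_scale)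
  have Cf: "(\<lambda>t. C * f t) \<in> P" using lin f unfolding linear_subspace_def by blast
  have "\<bar>h t - 1 * z t\<bar> \<le> \<bar>C * f t\<bar>" for t
    by (auto simp: z_def abs_mult intro: order_trans[OF _ mult_right_mono[OF abs_ge_self]])
  then have "(\<lambda>t. h t - 1 * z t) \<in> P" by (rule order_idealD[OF P dE Cf])
  then have "(\<lambda>t. (h t - 1 * z t) + z t) \<in> P" using z lin unfolding linear_subspace_def by fast
  then show ?thesis by simp
qed

text \<open>A function in \<open>P\<close> dominates, up to a constant near 0, the monomial of its
  smallest exponent; upward closure then puts all its exponents in \<open>U\<close>. Conversely, a
  germ over \<open>U\<close> agrees near 0 with a combination of monomials from
  \<open>P\<close>.\<close>

lemma ideal_eq_germs:
  assumes P: "order_ideal (RSK S K) P" and points: "\<And>n. point n \<in> P"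
  defines "U \<equiv> {s \<in> insert 0 S. monomial s \<in> P}"
  shows "P = germs U" and "\<And>u s. u \<in> U \<Longrightarrow> s \<in> insert 0 S \<Longrightarrow> u \<le> s \<Longrightarrow> s \<in> U"
proof -
  have lin: "linear_subspace (RSK S K) P" using P by (simp add: order_ideal_def)
  show upper: "s \<in> U" if u: "u \<in> U" and s: "s \<in> insert 0 S" and us: "u \<le> s" for u s
  proof -
    have u0: "0 \<le> u" and um: "monomial u \<in> P" using u S by (auto simp: U_def)
    have "monomial s \<in> RSK S K" using s by (simp add: RSK_eq_germs monomial_in_germs)
    moreover have "\<forall>\<^sub>F t in near. \<bar>monomial s t\<bar> \<le> 1 * \<bar>monomial u t\<bar>"
    proof -
      have "rat_pow t s \<le> rat_pow t u" if "0 \<le> t" "t \<le> 1" for t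
        using rat_pow_add[OF u0, of "s - u" t] rat_pow_le_one[OF that, of "s - u"] us
          mult_left_mono[of "rat_pow t (s - u)" 1 "rat_pow t u"] rat_pow_nonneg by simp
      then show ?thesis
        unfolding eventually_near_iff
        by (intro exI[of _ 1]) (auto simp: monomial_def rat_pow_nonneg)
    qed
    ultimately have "monomial s \<in> P" by (rule ideal_eventually_dominated[OF P points um])
    then show ?thesis using s by (simp add: U_def)
  qed
  show "P = germs U"
  proof (intro set_eqI iffI)
    fix f assume f: "f \<in> P"
    then have "f \<in> germs (insert 0 S)" using lin by (auto simp: linear_subspace_def RSK_eq_germs)
    then obtain g where off: "\<And>t. t \<notin> K \<Longrightarrow> f t = 0" and g: "Poly_Mapping.keys g \<subseteq> insert 0 S"
      and eq: "\<forall>\<^sub>F t in near. f t = gen_poly g t" by (auto elim: germsE)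
    have "Poly_Mapping.keys g \<subseteq> U"
    proof (cases "g = 0")
      case False
      have "0 \<le> s" if "s \<in> Poly_Mapping.keys g" for s using that g insert_zero_S_nonneg by auto
      with False obtain u q where u: "u \<in> Poly_Mapping.keys g" "\<And>s. s \<in> Poly_Mapping.keys g \<Longrightarrow> u \<le> s"
        and q: "(q \<longlongrightarrow> Poly_Mapping.lookup g u) near" "\<And>t. gen_poly g t = rat_pow t u * q t"
        using gen_poly_factor_Min[of g] by metis
      let ?a = "\<bar>Poly_Mapping.lookup g u\<bar>"
      have a: "0 < ?a" using u(1) by (simp add: in_keys_iff)
      have "((\<lambda>t. \<bar>q t\<bar>) \<longlongrightarrow> ?a) near" using q(1) by (rule tendsto_rabs)
      \<comment> \<open>Half the modulus of the leading coefficient is a positive lower bound for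
        \<open>q\<close> near 0, whence the constant \<open>2 / ?a\<close>.\<close>
      then have "\<forall>\<^sub>F t in near. ?a / 2 < \<bar>q t\<bar>" by (rule order_tendstoD) (use a in simp)
      then have "\<forall>\<^sub>F t in near. \<bar>monomial u t\<bar> \<le> (2 / ?a) * \<bar>f t\<bar>"
        using eq eventually_near_in_K
      proof eventually_elim
        case (elim t)
        have "1 \<le> (2 / ?a) * \<bar>q t\<bar>" using elim(1) a by (simp add: field_simps)
        from mult_left_mono[OF this rat_pow_nonneg[of t u]] show ?case
          using elim(2,3) q(2)[of t] rat_pow_nonneg[of t u]
          by (simp add: monomial_def abs_mult mult_ac)
      qed
      moreover have "monomial u \<in> RSK S K"
        using u(1) g by (auto simp: RSK_eq_germs intro: monomial_in_germs)
      ultimately have "monomial u \<in> P" using ideal_eventually_dominated[OF P points f] by blast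
      then have "u \<in> U" using u(1) g by (auto simp: U_def)
      then show ?thesis using upper u(2) g by blast
    qed simp
    then show "f \<in> germs U" using off eq by (intro germsI)
  next
    fix f assume "f \<in> germs U"
    then obtain g where off: "\<And>t. t \<notin> K \<Longrightarrow> f t = 0" and g: "Poly_Mapping.keys g \<subseteq> U"
      and eq: "\<forall>\<^sub>F t in near. f t = gen_poly g t" by (auto elim: germsE)
    define p where "p t = (\<Sum>s\<in>Poly_Mapping.keys g. Poly_Mapping.lookup g s * monomial s t)" for t
    have p: "p \<in> P"
      unfolding p_def[abs_def] using g by (intro linear_subspace_sum[OF lin]) (auto simp: U_def)
    have "(\<lambda>t. f t - p t) \<in> P"
    proof (rule eventually_zero_in_ideal[OF lin points])
      show "f t - p t = 0" if "t \<notin> K" for t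
        using that off by (simp add: p_def monomial_def)
      show "\<forall>\<^sub>F t in near. f t - p t = 0"
        using eq eventually_near_in_K
        by eventually_elim (simp add: p_def monomial_def gen_poly_def)
    qed
    then have "(\<lambda>t. (f t - p t) + p t) \<in> P" using p lin unfolding linear_subspace_def by fast
    then show "f \<in> P" by simp
  qed
qed

section \<open>Classification of the prime ideals\<close>

lemma prime_ideal_cases:
  assumes P: "prime_order_ideal (RSK S K) P"
  shows "(\<exists>n. P = MSK S K (\<alpha> n)) \<or> (\<exists>U\<in>upper_sets S. P = germs U)"
proof (cases "\<exists>n. point n \<notin> P")
  case True
  then show ?thesis using prime_ideal_eq_MSK[OF P] by blast
next
  case False
  define U where "U = {s \<in> insert 0 S. monomial s \<in> P}"
  have ideal: "order_ideal (RSK S K) P" and neq: "P \<noteq> RSK S K"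
    using P by (auto simp: prime_order_ideal_def)
  have PU: "P = germs U" and upper: "\<And>u s. u \<in> U \<Longrightarrow> s \<in> insert 0 S \<Longrightarrow> u \<le> s \<Longrightarrow> s \<in> U"
    using ideal_eq_germs[OF ideal] False unfolding U_def by blast+
  \<comment> \<open>Properness enters here: exponent 0 would force all exponents into
    \<open>U\<close> and make \<open>P\<close> the whole lattice.\<close>
  have "0 \<notin> U"
  proof
    assume "0 \<in> U"
    then have "insert 0 S \<subseteq> U" using upper insert_zero_S_nonneg by blast
    then have "U = insert 0 S" by (auto simp: U_def)
    then show False using PU neq by (simp add: RSK_eq_germs)
  qed
  then have "U \<in> upper_sets S" using upper by (auto simp: upper_sets_def U_def)
  then show ?thesis using PU by blast
qed

lemma germs_inj:
  assumes "U \<subseteq> S" "V \<subseteq> S" "germs U = germs V"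
  shows "U = V"
proof -
  have "s \<in> U \<longleftrightarrow> s \<in> V" if "s \<in> S" for s
    using assms S that by (subst (1 2) monomial_in_germs_iff[symmetric]) force+
  then show ?thesis using assms(1,2) by blast
qed

end

theorem mainTheorem4:
  fixes \<alpha> :: "nat \<Rightarrow> real" and K :: "real set" and S :: "rat set"
  assumes decreasing: "\<And>m n. m < n \<Longrightarrow> \<alpha> n < \<alpha> m"
    and null: "\<alpha> \<longlonglongrightarrow> 0"
    and K: "K = {\<alpha> n | n. True} \<union> {0}"
    and S: "S \<subseteq> {s. 0 < s}"
  shows "{P. prime_order_ideal (RSK S K) P}
           = {MSK S K (\<alpha> n) | n. True} \<union> {psi_preimage S K U | U. U \<in> upper_sets S}
    \<and> (\<forall>n. maximal_order_ideal (RSK S K) (MSK S K (\<alpha> n)))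
    \<and> (\<forall>U\<in>upper_sets S. psi_preimage S K U \<subseteq> MSK S K 0)
    \<and> (\<forall>m n. m \<noteq> n \<longrightarrow> MSK S K (\<alpha> m) \<noteq> MSK S K (\<alpha> n))
    \<and> (\<forall>U\<in>upper_sets S. \<forall>V\<in>upper_sets S. U \<noteq> V \<longrightarrow> psi_preimage S K U \<noteq> psi_preimage S K V)
    \<and> (\<forall>n. \<forall>U\<in>upper_sets S. MSK S K (\<alpha> n) \<noteq> psi_preimage S K U)
    \<and> bij_betw (case_sum (psi_preimage S K) (MSK S K))
        (upper_sets S <+> (K - {0})) {P. prime_order_ideal (RSK S K) P}"
proof -
  interpret null_sequence \<alpha> K S
    by unfold_locales (use assms in auto)
  have pre: "psi_preimage S K U = germs U" if "U \<in> upper_sets S" for U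
    using that by (simp add: upper_sets_def psi_preimage_eq_germs)
  have primes: "{P. prime_order_ideal (RSK S K) P}
      = {MSK S K (\<alpha> n) | n. True} \<union> {psi_preimage S K U | U. U \<in> upper_sets S}"
  proof (intro set_eqI iffI)
    fix P assume "P \<in> {P. prime_order_ideal (RSK S K) P}"
    then show "P \<in> {MSK S K (\<alpha> n) | n. True} \<union> {psi_preimage S K U | U. U \<in> upper_sets S}"
      using prime_ideal_cases[of P] by (auto simp flip: pre)
  next
    fix P assume "P \<in> {MSK S K (\<alpha> n) | n. True} \<union> {psi_preimage S K U | U. U \<in> upper_sets S}"
    then show "P \<in> {P. prime_order_ideal (RSK S K) P}"
      using prime_order_ideal_MSK prime_order_ideal_germs pre by auto
  qed
  have sub: "\<forall>U\<in>upper_sets S. psi_preimage S K U \<subseteq> MSK S K 0"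
    by (auto simp: psi_preimage_def)
  have MM: "\<forall>m n. m \<noteq> n \<longrightarrow> MSK S K (\<alpha> m) \<noteq> MSK S K (\<alpha> n)"
    using point_in_MSK_iff by metis
  have UV: "\<forall>U\<in>upper_sets S. \<forall>V\<in>upper_sets S. U \<noteq> V \<longrightarrow> psi_preimage S K U \<noteq> psi_preimage S K V"
    using germs_inj by (simp add: pre) (auto simp: upper_sets_def)
  have MU: "\<forall>n. \<forall>U\<in>upper_sets S. MSK S K (\<alpha> n) \<noteq> psi_preimage S K U"
    using point_in_MSK_iff point_in_germs by (metis pre)
  \<comment> \<open>The bijection is indexed by points of \<open>K\<close>, the preceding facts by
    natural numbers; this equation connects them.\<close>
  have KA: "K - {0} = range \<alpha>" using alpha_pos by (auto simp: K less_le)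
  have "bij_betw (case_sum (psi_preimage S K) (MSK S K))
      (upper_sets S <+> (K - {0})) {P. prime_order_ideal (RSK S K) P}"
    unfolding bij_betw_def
  proof
    show "inj_on (case_sum (psi_preimage S K) (MSK S K)) (upper_sets S <+> (K - {0}))"
    proof (rule inj_onI)
      fix x y
      assume x: "x \<in> upper_sets S <+> (K - {0})" and y: "y \<in> upper_sets S <+> (K - {0})"
        and eq: "case_sum (psi_preimage S K) (MSK S K) x = case_sum (psi_preimage S K) (MSK S K) y"
      show "x = y"
        using x y eq MM UV MU unfolding KA by (elim PlusE imageE) (simp_all, metis+)
    qed
    show "case_sum (psi_preimage S K) (MSK S K) ` (upper_sets S <+> (K - {0}))
        = {P. prime_order_ideal (RSK S K) P}"
      unfolding primes KA Plus_def image_Un image_image by auto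
  qed
  then show ?thesis
    using primes maximal_order_ideal_MSK sub MM UV MU by blast
qed

end
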